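(* Let $n\ge 1$, let $T=e_1T_1+e_2T_2\in L_1^n\times_eL_1^n$ be a linear operator on $\mathbb{C}_2^n$ (over $\mathbb{C}_1$), and let $\Upsilon_1,\Upsilon_2\subseteq\mathbb{C}_1$ be the sets of all eigenvalues of $T_1$ and $T_2$, respectively. Let $\kappa=\kappa_1e_1+\kappa_2e_2$ (with $\kappa_1,\kappa_2\in\mathbb{C}_1$) be a modified eigenvalue of $T$ such that $\kappa_1\in\Upsilon_1$ and $\kappa_2\notin\Upsilon_2$. Then $${}^T(ME)_\kappa={}^{T_1}(E)_{\kappa_1}\times_e\{0\}.$$
   Context: $\mathbb{C}_1$ denotes the complex numbers with imaginary unit $i_1$. The bicomplex numbers are $\mathbb{C}_2=\{z_1+i_2z_2 : z_1,z_2\in\mathbb{C}_1\}$, a commutative $\mathbb{C}_1$-algebra with $i_1^2=i_2^2=-1$, $i_1i_2=i_2i_1$. Put $e_1=(1+i_1i_2)/2$ and $e_2=(1-i_1i_2)/2$; these are idempotents with $e_1+e_2=1$, $e_1e_2=0$. Every $\xi=z_1+i_2z_2\in\mathbb{C}_2$ is uniquely $\xi=\xi^-e_1+\xi^+e_2$ with $\xi^-=z_1-i_1z_2$, $\xi^+=z_1+i_1z_2\in\mathbb{C}_1$. $\mathbb{C}_2^n$ is regarded as a vector space over $\mathbb{C}_1$; bicomplex scalars act on it componentwise. $L_1^n$ is the set of $\mathbb{C}_1$-linear operators $\mathbb{C}_1^n\to\mathbb{C}_1^n$. For $T_1,T_2\in L_1^n$, $T=e_1T_1+e_2T_2$ is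 the $\mathbb{C}_1$-linear operator on $\mathbb{C}_2^n$ given by $T(\xi_1,\dots,\xi_n)=e_1T_1(\xi_1^-,\dots,\xi_n^-)+e_2T_2(\xi_1^+,\dots,\xi_n^+)$, and $L_1^n\times_eL_1^n$ is the set of all such operators. A scalar $\kappa\in\mathbb{C}_2$ is a modified eigenvalue of $T$ if there is a nonzero $x\in\mathbb{C}_2^n$ with $T(x)=\kappa x$; its modified eigenspace is ${}^T(ME)_\kappa=\{x\in\mathbb{C}_2^n : T(x)=\kappa x\}$. For an eigenvalue $z$ of $T_j$ ($j=1,2$), ${}^{T_j}(E)_z=\{v\in\mathbb{C}_1^n : T_j(v)=zv\}$. For $S_1,S_2\subseteq\mathbb{C}_1^n$, the idempotent product is $S_1\times_eS_2=\{e_1x+e_2y : x\in S_1,\ y\in S_2\}\subseteq\mathbb{C}_2^n$. *)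

theory Defs
  imports "HOL-Analysis.Analysis"
begin

section \<open>Bicomplex numbers\<close>

text \<open>\<open>Bicomplex z1 z2\<close> stands for $z_1 + i_2 z_2$; the type \<^typ>\<open>complex\<close>
  plays the role of $\mathbb{C}_1$, its imaginary unit being $i_1$.\<close>

datatype bicomplex = Bicomplex (bc1: complex) (bc2: complex)

lemma bicomplex_eq_iff: "x = y \<longleftrightarrow> bc1 x = bc1 y \<and> bc2 x = bc2 y"
  by (cases x; cases y) simp

instantiation bicomplex :: comm_ring_1
begin

definition zero_bicomplex :: bicomplex where "0 = Bicomplex 0 0"
definition one_bicomplex :: bicomplex where "1 = Bicomplex 1 0"
definition plus_bicomplex :: "bicomplex \<Rightarrow> bicomplex \<Rightarrow> bicomplex" where
  "x + y = Bicomplex (bc1 x + bc1 y) (bc2 x + bc2 y)"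
definition uminus_bicomplex :: "bicomplex \<Rightarrow> bicomplex" where
  "- x = Bicomplex (- bc1 x) (- bc2 x)"
definition minus_bicomplex :: "bicomplex \<Rightarrow> bicomplex \<Rightarrow> bicomplex" where
  "x - y = Bicomplex (bc1 x - bc1 y) (bc2 x - bc2 y)"
definition times_bicomplex :: "bicomplex \<Rightarrow> bicomplex \<Rightarrow> bicomplex" where
  "x * y = Bicomplex (bc1 x * bc1 y - bc2 x * bc2 y) (bc1 x * bc2 y + bc2 x * bc1 y)"

instance
  by standard
    (simp_all add: zero_bicomplex_def one_bicomplex_def plus_bicomplex_def
      uminus_bicomplex_def minus_bicomplex_def times_bicomplex_def algebra_simps)

end

lemma bicomplex_sel_simps [simp]:
  "bc1 0 = 0" "bc2 0 = 0" "bc1 1 = 1" "bc2 1 = 0"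
  "bc1 (x + y) = bc1 x + bc1 y" "bc2 (x + y) = bc2 x + bc2 y"
  "bc1 (- x) = - bc1 x" "bc2 (- x) = - bc2 x"
  "bc1 (x - y) = bc1 x - bc1 y" "bc2 (x - y) = bc2 x - bc2 y"
  "bc1 (x * y) = bc1 x * bc1 y - bc2 x * bc2 y"
  "bc2 (x * y) = bc1 x * bc2 y + bc2 x * bc1 y"
  by (simp_all add: zero_bicomplex_def one_bicomplex_def plus_bicomplex_def
      uminus_bicomplex_def minus_bicomplex_def times_bicomplex_def)

lemma bicomplex_sel_numeral [simp]: "bc1 (numeral w) = numeral w" "bc2 (numeral w) = 0"
  by (induction w) (simp_all only: numeral.simps bicomplex_sel_simps add_0_left)

definition of_C1 :: "complex \<Rightarrow> bicomplex" where
  "of_C1 z = Bicomplex z 0"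

definition bi_i1 :: bicomplex where "bi_i1 = of_C1 \<i>"
definition bi_i2 :: bicomplex where "bi_i2 = Bicomplex 0 1"

definition bi_e1 :: bicomplex where "bi_e1 = of_C1 (1/2) * (1 + bi_i1 * bi_i2)"
definition bi_e2 :: bicomplex where "bi_e2 = of_C1 (1/2) * (1 - bi_i1 * bi_i2)"

definition minus_part :: "bicomplex \<Rightarrow> complex" where
  "minus_part \<xi> = bc1 \<xi> - \<i> * bc2 \<xi>"

definition plus_part :: "bicomplex \<Rightarrow> complex" where
  "plus_part \<xi> = bc1 \<xi> + \<i> * bc2 \<xi>"

lemmas bi_unit_defs = of_C1_def bi_i1_def bi_i2_def bi_e1_def bi_e2_def

lemma bicomplex_decomp: "\<xi> = of_C1 (bc1 \<xi>) + bi_i2 * of_C1 (bc2 \<xi>)"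
  by (simp add: bicomplex_eq_iff bi_unit_defs)

lemma bi_units:
  "bi_i1 * bi_i1 = - 1" "bi_i2 * bi_i2 = - 1"
  "2 * bi_e1 = 1 + bi_i1 * bi_i2" "2 * bi_e2 = 1 - bi_i1 * bi_i2"
  "bi_e1 * bi_e1 = bi_e1" "bi_e2 * bi_e2 = bi_e2"
  "bi_e1 + bi_e2 = 1" "bi_e1 * bi_e2 = 0"
  by (simp_all add: bicomplex_eq_iff bi_unit_defs)

lemma idempotent_decomp:
  "\<xi> = of_C1 (minus_part \<xi>) * bi_e1 + of_C1 (plus_part \<xi>) * bi_e2"
  by (simp add: bicomplex_eq_iff bi_unit_defs minus_part_def plus_part_def field_simps)

lemma idempotent_parts:
  "minus_part (of_C1 a * bi_e1 + of_C1 b * bi_e2) = a"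
  "plus_part (of_C1 a * bi_e1 + of_C1 b * bi_e2) = b"
  by (simp_all add: bi_unit_defs minus_part_def plus_part_def field_simps)


section \<open>Operators and eigenspaces\<close>

text \<open>The spaces $\mathbb{C}_1^n$ and $\mathbb{C}_2^n$ are \<^typ>\<open>complex^'n\<close> and
  \<^typ>\<open>bicomplex^'n\<close>; in both cases \<^term>\<open>(*s)\<close> is the componentwise action of
  scalars. As a vector space over $\mathbb{C}_1$, the latter carries the scalar
  multiplication \<open>\<lambda>c x. of_C1 c *s x\<close>.\<close>

definition of_C1_vec :: "complex^'n \<Rightarrow> bicomplex^'n" where
  "of_C1_vec v = (\<chi> i. of_C1 (v $ i))"

definition minus_vec :: "bicomplex^'n \<Rightarrow> complex^'n" where
  "minus_vec x = (\<chi> i. minus_part (x $ i))"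

definition plus_vec :: "bicomplex^'n \<Rightarrow> complex^'n" where
  "plus_vec x = (\<chi> i. plus_part (x $ i))"

definition L1 :: "(complex^'n \<Rightarrow> complex^'n) set" where
  "L1 = {S. Vector_Spaces.linear (*s) (*s) S}"

text \<open>\<open>idem_op T1 T2\<close> is the operator $e_1 T_1 + e_2 T_2$ on $\mathbb{C}_2^n$.\<close>

definition idem_op ::
    "(complex^'n \<Rightarrow> complex^'n) \<Rightarrow> (complex^'n \<Rightarrow> complex^'n) \<Rightarrow> bicomplex^'n \<Rightarrow> bicomplex^'n" where
  "idem_op T1 T2 = (\<lambda>x. bi_e1 *s of_C1_vec (T1 (minus_vec x)) + bi_e2 *s of_C1_vec (T2 (plus_vec x)))"

definition L1_times_e_L1 :: "(bicomplex^'n \<Rightarrow> bicomplex^'n) set" where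
  "L1_times_e_L1 = {idem_op T1 T2 | T1 T2. T1 \<in> L1 \<and> T2 \<in> L1}"

definition idem_prod :: "(complex^'n) set \<Rightarrow> (complex^'n) set \<Rightarrow> (bicomplex^'n) set"
    (infixr "\<times>\<^sub>e" 80) where
  "S1 \<times>\<^sub>e S2 = {bi_e1 *s of_C1_vec x + bi_e2 *s of_C1_vec y | x y. x \<in> S1 \<and> y \<in> S2}"

definition eigenvalues :: "(complex^'n \<Rightarrow> complex^'n) \<Rightarrow> complex set" where
  "eigenvalues S = {z. \<exists>v. v \<noteq> 0 \<and> S v = z *s v}"

definition eigenspace :: "(complex^'n \<Rightarrow> complex^'n) \<Rightarrow> complex \<Rightarrow> (complex^'n) set" where
  "eigenspace S z = {v. S v = z *s v}"

definition modified_eigenvalue :: "(bicomplex^'n \<Rightarrow> bicomplex^'n) \<Rightarrow> bicomplex \<Rightarrow> bool" where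
  "modified_eigenvalue T \<kappa> \<longleftrightarrow> (\<exists>x. x \<noteq> 0 \<and> T x = \<kappa> *s x)"

definition modified_eigenspace :: "(bicomplex^'n \<Rightarrow> bicomplex^'n) \<Rightarrow> bicomplex \<Rightarrow> (bicomplex^'n) set" where
  "modified_eigenspace T \<kappa> = {x. T x = \<kappa> *s x}"

lemma vector_space_bicomplex_vec:
  "vector_space (\<lambda>c (x :: bicomplex^'n). of_C1 c *s x)"
  by standard (simp_all add: vec_eq_iff bicomplex_eq_iff of_C1_def algebra_simps)

lemma L1_times_e_L1_linear:
  assumes "T \<in> (L1_times_e_L1 :: (bicomplex^'n \<Rightarrow> bicomplex^'n) set)"
  shows "Vector_Spaces.linear (\<lambda>c x. of_C1 c *s x) (\<lambda>c x. of_C1 c *s x) T"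
proof -
  obtain T1 T2 :: "complex^'n \<Rightarrow> complex^'n" where T: "T = idem_op T1 T2"
    and lin: "Vector_Spaces.linear (*s) (*s) T1" "Vector_Spaces.linear (*s) (*s) T2"
    using assms by (auto simp: L1_times_e_L1_def L1_def)
  note add = lin[THEN Vector_Spaces.linear.axioms(3), THEN module_hom.add]
  note scale = lin[THEN Vector_Spaces.linear.axioms(3), THEN module_hom.scale]
  have parts: "minus_vec (x + y) = minus_vec x + minus_vec y"
    "plus_vec (x + y) = plus_vec x + plus_vec y"
    "minus_vec (of_C1 c *s x) = c *s minus_vec x"
    "plus_vec (of_C1 c *s x) = c *s plus_vec x" for x y :: "bicomplex^'n" and c
    by (simp_all add: vec_eq_iff minus_vec_def plus_vec_def minus_part_def plus_part_def
        of_C1_def algebra_simps)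
  have embed: "of_C1_vec (v + w) = of_C1_vec v + of_C1_vec w"
    "of_C1_vec (c *s v) = of_C1 c *s of_C1_vec v" for v w :: "complex^'n" and c
    by (simp_all add: vec_eq_iff of_C1_vec_def bicomplex_eq_iff of_C1_def)
  interpret vector_space "\<lambda>c (x :: bicomplex^'n). of_C1 c *s x"
    by (rule vector_space_bicomplex_vec)
  show ?thesis
  proof
    show "T (x + y) = T x + T y" for x y
      by (simp add: T idem_op_def parts add embed vec_eq_iff algebra_simps)
    show "T (of_C1 c *s x) = of_C1 c *s T x" for c x
      by (simp add: T idem_op_def parts scale embed vec_eq_iff algebra_simps)
  qed
qed

end

theory Submission
  imports Defs
begin

text \<open>The two maps \<open>\<xi> \<mapsto> \<xi>\<^sup>-\<close> and \<open>\<xi> \<mapsto> \<xi>\<^sup>+\<close> are multiplicative and together determine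
  \<open>\<xi>\<close>, so applying them componentwise identifies $\mathbb{C}_2^n$ with pairs of vectors of
  $\mathbb{C}_1^n$. Under this identification \<open>e\<^sub>1T\<^sub>1 + e\<^sub>2T\<^sub>2\<close> acts as \<open>T\<^sub>1\<close> on the first
  component and as \<open>T\<^sub>2\<close> on the second, while \<open>\<kappa>\<close> acts as multiplication by \<open>\<kappa>\<^sup>-\<close> and
  \<open>\<kappa>\<^sup>+\<close>. The equation \<open>T x = \<kappa> x\<close> therefore decouples into one eigenvalue equation for each
  component, and the modified eigenspace is always the idempotent product of the two eigenspaces
  (lemma \<open>modified_eigenspace_idem_op\<close>). A scalar that is not an eigenvalue of the linear
  operator \<open>T\<^sub>2\<close> has \<open>{0}\<close> as its eigenspace, which gives the theorem.\<close>

lemma minus_part_mult: "minus_part (\<xi> * \<eta>) = minus_part \<xi> * minus_part \<eta>"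
  by (simp add: minus_part_def algebra_simps)

lemma plus_part_mult: "plus_part (\<xi> * \<eta>) = plus_part \<xi> * plus_part \<eta>"
  by (simp add: plus_part_def algebra_simps)

lemma minus_vec_scale: "minus_vec (c *s x) = minus_part c *s minus_vec x"
  by (simp add: vec_eq_iff minus_vec_def minus_part_mult)

lemma plus_vec_scale: "plus_vec (c *s x) = plus_part c *s plus_vec x"
  by (simp add: vec_eq_iff plus_vec_def plus_part_mult)

lemma idempotent_parts_vec:
  "minus_vec (bi_e1 *s of_C1_vec v + bi_e2 *s of_C1_vec w) = v"
  "plus_vec (bi_e1 *s of_C1_vec v + bi_e2 *s of_C1_vec w) = w"
  by (simp_all add: vec_eq_iff minus_vec_def plus_vec_def of_C1_vec_def
      idempotent_parts mult.commute[of bi_e1] mult.commute[of bi_e2])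

lemma idempotent_decomp_vec:
  "x = bi_e1 *s of_C1_vec (minus_vec x) + bi_e2 *s of_C1_vec (plus_vec x)"
  by (simp add: vec_eq_iff minus_vec_def plus_vec_def of_C1_vec_def
      mult.commute[of bi_e1] mult.commute[of bi_e2] idempotent_decomp[symmetric])

lemma bicomplex_vec_eq_iff_parts:
  "x = y \<longleftrightarrow> minus_vec x = minus_vec y \<and> plus_vec x = plus_vec y"
  by (metis idempotent_decomp_vec)

lemma mem_idem_prod_iff: "x \<in> S1 \<times>\<^sub>e S2 \<longleftrightarrow> minus_vec x \<in> S1 \<and> plus_vec x \<in> S2"
  unfolding idem_prod_def using idempotent_decomp_vec[of x] by (auto simp: idempotent_parts_vec)

text \<open>Taking both parts of \<open>T x = \<kappa> x\<close> gives \<open>T\<^sub>1 x\<^sup>- = \<kappa>\<^sup>- x\<^sup>-\<close> and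
  \<open>T\<^sub>2 x\<^sup>+ = \<kappa>\<^sup>+ x\<^sup>+\<close>, and nothing is lost because the parts determine a vector.\<close>

lemma modified_eigenspace_idem_op:
  "modified_eigenspace (idem_op T1 T2) \<kappa> =
    eigenspace T1 (minus_part \<kappa>) \<times>\<^sub>e eigenspace T2 (plus_part \<kappa>)"
  by (auto simp: modified_eigenspace_def eigenspace_def mem_idem_prod_iff idem_op_def
      bicomplex_vec_eq_iff_parts idempotent_parts_vec minus_vec_scale plus_vec_scale)

lemma eigenspace_eq_zero:
  assumes "S \<in> L1" and "z \<notin> eigenvalues S"
  shows "eigenspace S z = {0}"
proof -
  have "S 0 = 0"
    using assms(1) unfolding L1_def
    by (auto dest: Vector_Spaces.linear.axioms(3) module_hom.zero)
  then show ?thesis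
    using assms(2) by (auto simp: eigenspace_def eigenvalues_def)
qed

theorem theorem3p14:
  fixes T :: "bicomplex^'n \<Rightarrow> bicomplex^'n"
    and T1 T2 :: "complex^'n \<Rightarrow> complex^'n"
    and \<Upsilon>1 \<Upsilon>2 :: "complex set"
    and \<kappa> :: bicomplex and \<kappa>1 \<kappa>2 :: complex
  assumes "T1 \<in> L1" and "T2 \<in> L1" and "T = idem_op T1 T2"
    and "\<Upsilon>1 = eigenvalues T1" and "\<Upsilon>2 = eigenvalues T2"
    and "\<kappa> = of_C1 \<kappa>1 * bi_e1 + of_C1 \<kappa>2 * bi_e2"
    and "modified_eigenvalue T \<kappa>"
    and "\<kappa>1 \<in> \<Upsilon>1" and "\<kappa>2 \<notin> \<Upsilon>2"
  shows "modified_eigenspace T \<kappa> = eigenspace T1 \<kappa>1 \<times>\<^sub>e {0}"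
  using assms
  by (simp add: modified_eigenspace_idem_op idempotent_parts eigenspace_eq_zero)

end
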